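(* Let $G=(e_X,e_Y,R)$ and $G'=(e_{X'},e_{Y'},R')$ be Galois polarities extending posets $P$ and $P'$ respectively, with $\gamma:P\to X\uplus Y$ and $\gamma':P'\to X'\uplus Y'$ as below, and let $h=(h_X,h_P,h_Y):G\to G'$ be a polarity morphism. Define $\psi_h:X\uplus Y\to X'\uplus Y'$ by $\psi_h(\iota_X(x))=\iota_{X'}(h_X(x))$ for $x\in X$ and $\psi_h(\iota_Y(y))=\iota_{Y'}(h_Y(y))$ for $y\in Y$. Then: (1) $\psi_h$ is well defined and is the unique map $\psi:X\uplus Y\to X'\uplus Y'$ with $\psi\circ\iota_X=\iota_{X'}\circ h_X$, $\psi\circ\iota_Y=\iota_{Y'}\circ h_Y$ and $\psi\circ\gamma=\gamma'\circ h_P$; (2) $\psi_h$ is Galois-stable; (3) $\psi_h$ is an order embedding if and only if $h$ is a polarity embedding; (4) if $h_X$ and $h_Y$ are both surjective, then $\psi_h$ is surjective.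
   Context: For a poset $Q$, $q^\uparrow=\{r:r\ge q\}$, $q^\downarrow=\{r:r\le q\}$. An order embedding $e:P\to Q$ is a meet-extension if $q=\bigwedge e[e^{-1}(q^\uparrow)]$ for all $q$, and a join-extension if $q=\bigvee e[e^{-1}(q^\downarrow)]$ for all $q$. An extension polarity is a triple $(e_X,e_Y,R)$ where $P$ is a poset, $e_X:P\to X$, $e_Y:P\to Y$ order embeddings into disjoint posets, $R\subseteq X\times Y$. It is 3-coherent if (variables over $X,Y,P$): (C1) $x_1\le_X x_2$ and $x_2\mathrel{R}y$ imply $x_1\mathrel{R}y$; (C2) $y_1\le_Y y_2$ and $x\mathrel{R}y_1$ imply $x\mathrel{R}y_2$; (C3) $e_X(p)\mathrel{R}e_Y(p)$; (C4) $x\mathrel{R}e_Y(p)$ and $e_X(p)\mathrel{R}y$ imply $x\mathrel{R}y$; (C5) $x_1\mathrel{R}e_Y(p)$ and $e_X(p)\le_X x_2$ imply $x_1\le_X x_2$; (C6) $y_1\le_Y e_Y(p)$ and $e_X(p)\mathrel{R}y_2$ imply $y_1\le_Y y_2$; (C7) if $S\subseteq P$, $\bigwedge e_X[S]=x$ in $X$, $x\mathrel{R}y_2$, $y_1\le_Y e_Y(p)$ for all $p\in S$, then $y_1\le_Y y_2$; (C8) if $T\subseteq P$, $\bigvee e_Y[T]=y$ in $Y$, $x_1\mathrel{R}y$, $e_X(q)\le_X x_2$ for all $q\in T$, then $x_1\le_X x_2$. A Galois polarity is a 3-coherent extension polarity with $e_X$ a meet-extension and $e_Y$ a join-extension. For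 a Galois polarity, let $\preceq$ be the preorder ${\le_X}\cup{\le_Y}\cup R\cup\{(y,x)\in Y\times X:\forall p,q\in P\,(e_Y(p)\le_Y y\text{ and }x\le_X e_X(q)\Rightarrow p\le_P q)\}$ on $X\cup Y$ (this is the unique "3-preorder" of the polarity: the unique preorder on $X\cup Y$ agreeing with $R$ on $X\times Y$, extending $\le_X,\le_Y$, making the maps below order embeddings with $\iota_X\circ e_X=\iota_Y\circ e_Y$, $\iota_X$ preserving existing meets of subsets of $e_X[P]$ and $\iota_Y$ preserving existing joins of subsets of $e_Y[P]$). $X\uplus Y$ is the quotient poset obtained by identifying $z_1,z_2$ when $z_1\preceq z_2\preceq z_1$; $\iota_X:X\to X\uplus Y$, $\iota_Y:Y\to X\uplus Y$ are inclusion followed by quotient; $\gamma=\iota_X\circ e_X=\iota_Y\circ e_Y$. Similarly for $G'$. A polarity morphism $h=(h_X,h_P,h_Y):G\to G'$ is a triple of order preserving maps $h_X:X\to X'$, $h_P:P\to P'$, $h_Y:Y\to Y'$ such that: (M1) $h_X\circ e_X=e_{X'}\circ h_P$ and $h_Y\circ e_Y=e_{Y'}\circ h_P$; (M2) for all $x\in X,y\in Y$, $\iota_Y(y)\le\iota_X(x)$ implies $\iota_{Y'}(h_Y(y))\le\iota_{X'}(h_X(x))$; (M3) for all $x'\in X'$, $y'\in Y'$ with $(x',y')\notin R'$ there are $x\in X$, $y\in Y$ such that (i) $h_X^{-1}(x'^\uparrow)\subseteq x^\uparrow$, (ii) $h_Y^{-1}(y'^\downarrow)\subseteq y^\downarrow$,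 (iii) $h_X(a)\mathrel{R'}y'\Rightarrow a\mathrel{R}y$ for all $a\in X$, (iv) $x'\mathrel{R'}h_Y(b)\Rightarrow x\mathrel{R}b$ for all $b\in Y$, (v) $(x,y)\notin R$. $h$ is a polarity embedding if moreover $h_X,h_P,h_Y$ are order embeddings and $h_X(x)\mathrel{R'}h_Y(y)\Rightarrow x\mathrel{R}y$ for all $x\in X,y\in Y$. An order preserving map $f:A\to B$ between posets is cut-stable if whenever $b_1\not\le b_2$ in $B$ there are $a_1\not\le a_2$ in $A$ with $f^{-1}(b_1^\uparrow)\subseteq a_1^\uparrow$ and $f^{-1}(b_2^\downarrow)\subseteq a_2^\downarrow$. A map $\psi:X\uplus Y\to X'\uplus Y'$ is Galois-stable if it is order preserving, cut-stable, and satisfies (G1) $\psi\circ\gamma[P]\subseteq\gamma'[P']$, (G2) $\psi\circ\iota_X[X]\subseteq\iota_{X'}[X']$, (G3) $\psi\circ\iota_Y[Y]\subseteq\iota_{Y'}[Y']$. *)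

theory Defs
  imports "HOL-Algebra.Order"
begin

text \<open>
  Posets are structures \<open>L\<close> with \<^prop>\<open>partial_order L\<close>, so that
  carriers may be empty and all order-theoretic notions are relative to the carrier.
\<close>

definition up :: "('a, 'c) gorder_scheme \<Rightarrow> 'a \<Rightarrow> 'a set"
  where "up L q = {r \<in> carrier L. q \<sqsubseteq>\<^bsub>L\<^esub> r}"

definition down :: "('a, 'c) gorder_scheme \<Rightarrow> 'a \<Rightarrow> 'a set"
  where "down L q = {r \<in> carrier L. r \<sqsubseteq>\<^bsub>L\<^esub> q}"

definition preimage :: "('a, 'c) gorder_scheme \<Rightarrow> ('a \<Rightarrow> 'b) \<Rightarrow> 'b set \<Rightarrow> 'a set"
  where "preimage A f S = {a \<in> carrier A. f a \<in> S}"

definition order_preserving ::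
  "('a, 'c) gorder_scheme \<Rightarrow> ('b, 'd) gorder_scheme \<Rightarrow> ('a \<Rightarrow> 'b) \<Rightarrow> bool"
  where "order_preserving A B f \<longleftrightarrow> f \<in> carrier A \<rightarrow> carrier B \<and> isotone A B f"

definition order_embedding ::
  "('a, 'c) gorder_scheme \<Rightarrow> ('b, 'd) gorder_scheme \<Rightarrow> ('a \<Rightarrow> 'b) \<Rightarrow> bool"
  where "order_embedding A B f \<longleftrightarrow> f \<in> carrier A \<rightarrow> carrier B \<and> order_emb A B f"

definition meet_extension ::
  "('p, 'c) gorder_scheme \<Rightarrow> ('a, 'd) gorder_scheme \<Rightarrow> ('p \<Rightarrow> 'a) \<Rightarrow> bool"
  where "meet_extension P Q e \<longleftrightarrow>
    order_embedding P Q e \<and> (\<forall>q\<in>carrier Q. is_glb Q q (e ` preimage P e (up Q q)))"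

definition join_extension ::
  "('p, 'c) gorder_scheme \<Rightarrow> ('a, 'd) gorder_scheme \<Rightarrow> ('p \<Rightarrow> 'a) \<Rightarrow> bool"
  where "join_extension P Q e \<longleftrightarrow>
    order_embedding P Q e \<and> (\<forall>q\<in>carrier Q. is_lub Q q (e ` preimage P e (down Q q)))"

definition cut_stable ::
  "('a, 'c) gorder_scheme \<Rightarrow> ('b, 'd) gorder_scheme \<Rightarrow> ('a \<Rightarrow> 'b) \<Rightarrow> bool"
  where "cut_stable A B f \<longleftrightarrow>
    order_preserving A B f \<and>
    (\<forall>b1\<in>carrier B. \<forall>b2\<in>carrier B. \<not> b1 \<sqsubseteq>\<^bsub>B\<^esub> b2 \<longrightarrow>
      (\<exists>a1\<in>carrier A. \<exists>a2\<in>carrier A. \<not> a1 \<sqsubseteq>\<^bsub>A\<^esub> a2 \<and>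
        preimage A f (up B b1) \<subseteq> up A a1 \<and>
        preimage A f (down B b2) \<subseteq> down A a2))"

text \<open>
  The posets \<open>X\<close> and \<open>Y\<close> live in one type and are required to have disjoint carriers, so
  \<open>X \<union> Y\<close> is a plain union and the inclusions of \<open>X\<close> and \<open>Y\<close> into it are the identity.
\<close>

record ('p, 'a) polarity =
  polP :: "'p gorder"
  polX :: "'a gorder"
  polY :: "'a gorder"
  embX :: "'p \<Rightarrow> 'a"
  embY :: "'p \<Rightarrow> 'a"
  polR :: "('a \<times> 'a) set"

definition extension_polarity :: "('p, 'a) polarity \<Rightarrow> bool"
  where "extension_polarity G \<longleftrightarrow>
    partial_order (polP G) \<and> partial_order (polX G) \<and> partial_order (polY G) \<and>
    carrier (polX G) \<inter> carrier (polY G) = {} \<and>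
    order_embedding (polP G) (polX G) (embX G) \<and>
    order_embedding (polP G) (polY G) (embY G) \<and>
    polR G \<subseteq> carrier (polX G) \<times> carrier (polY G)"

locale three_coherent =
  fixes G :: "('p, 'a) polarity"
  assumes extension_polarity: "extension_polarity G"
    and C1: "\<lbrakk>x1 \<in> carrier (polX G); x2 \<in> carrier (polX G); y \<in> carrier (polY G);
        x1 \<sqsubseteq>\<^bsub>polX G\<^esub> x2; (x2, y) \<in> polR G\<rbrakk> \<Longrightarrow> (x1, y) \<in> polR G"
    and C2: "\<lbrakk>y1 \<in> carrier (polY G); y2 \<in> carrier (polY G); x \<in> carrier (polX G);
        y1 \<sqsubseteq>\<^bsub>polY G\<^esub> y2; (x, y1) \<in> polR G\<rbrakk> \<Longrightarrow> (x, y2) \<in> polR G"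
    and C3: "p \<in> carrier (polP G) \<Longrightarrow> (embX G p, embY G p) \<in> polR G"
    and C4: "\<lbrakk>x \<in> carrier (polX G); y \<in> carrier (polY G); p \<in> carrier (polP G);
        (x, embY G p) \<in> polR G; (embX G p, y) \<in> polR G\<rbrakk> \<Longrightarrow> (x, y) \<in> polR G"
    and C5: "\<lbrakk>x1 \<in> carrier (polX G); x2 \<in> carrier (polX G); p \<in> carrier (polP G);
        (x1, embY G p) \<in> polR G; embX G p \<sqsubseteq>\<^bsub>polX G\<^esub> x2\<rbrakk> \<Longrightarrow> x1 \<sqsubseteq>\<^bsub>polX G\<^esub> x2"
    and C6: "\<lbrakk>y1 \<in> carrier (polY G); y2 \<in> carrier (polY G); p \<in> carrier (polP G);
        y1 \<sqsubseteq>\<^bsub>polY G\<^esub> embY G p; (embX G p, y2) \<in> polR G\<rbrakk> \<Longrightarrow> y1 \<sqsubseteq>\<^bsub>polY G\<^esub> y2"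
    and C7: "\<lbrakk>S \<subseteq> carrier (polP G); x \<in> carrier (polX G);
        y1 \<in> carrier (polY G); y2 \<in> carrier (polY G);
        is_glb (polX G) x (embX G ` S); (x, y2) \<in> polR G;
        \<And>p. p \<in> S \<Longrightarrow> y1 \<sqsubseteq>\<^bsub>polY G\<^esub> embY G p\<rbrakk> \<Longrightarrow> y1 \<sqsubseteq>\<^bsub>polY G\<^esub> y2"
    and C8: "\<lbrakk>T \<subseteq> carrier (polP G); y \<in> carrier (polY G);
        x1 \<in> carrier (polX G); x2 \<in> carrier (polX G);
        is_lub (polY G) y (embY G ` T); (x1, y) \<in> polR G;
        \<And>q. q \<in> T \<Longrightarrow> embX G q \<sqsubseteq>\<^bsub>polX G\<^esub> x2\<rbrakk> \<Longrightarrow> x1 \<sqsubseteq>\<^bsub>polX G\<^esub> x2"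

locale galois_polarity = three_coherent +
  assumes meet_ext: "meet_extension (polP G) (polX G) (embX G)"
    and join_ext: "join_extension (polP G) (polY G) (embY G)"

definition preceq :: "('p, 'a) polarity \<Rightarrow> ('a \<times> 'a) set"
  where "preceq G =
    {(x1, x2). x1 \<in> carrier (polX G) \<and> x2 \<in> carrier (polX G) \<and> x1 \<sqsubseteq>\<^bsub>polX G\<^esub> x2} \<union>
    {(y1, y2). y1 \<in> carrier (polY G) \<and> y2 \<in> carrier (polY G) \<and> y1 \<sqsubseteq>\<^bsub>polY G\<^esub> y2} \<union>
    polR G \<union>
    {(y, x). y \<in> carrier (polY G) \<and> x \<in> carrier (polX G) \<and>
      (\<forall>p\<in>carrier (polP G). \<forall>q\<in>carrier (polP G).
        embY G p \<sqsubseteq>\<^bsub>polY G\<^esub> y \<and> x \<sqsubseteq>\<^bsub>polX G\<^esub> embX G q \<longrightarrow> p \<sqsubseteq>\<^bsub>polP G\<^esub> q)}"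

definition preceq_equiv :: "('p, 'a) polarity \<Rightarrow> ('a \<times> 'a) set"
  where "preceq_equiv G = preceq G \<inter> (preceq G)\<inverse>"

text \<open>The poset \<open>X \<uplus> Y\<close>, whose elements are equivalence classes.\<close>

definition amalgam :: "('p, 'a) polarity \<Rightarrow> 'a set gorder"
  where "amalgam G =
    \<lparr>carrier = (carrier (polX G) \<union> carrier (polY G)) // preceq_equiv G,
     eq = (=),
     le = (\<lambda>C D. \<exists>z\<in>C. \<exists>w\<in>D. (z, w) \<in> preceq G)\<rparr>"

text \<open>The quotient map; its restrictions to the carriers of \<open>X\<close> and \<open>Y\<close> are \<open>iotaX\<close> and \<open>iotaY\<close>.\<close>

definition iota :: "('p, 'a) polarity \<Rightarrow> 'a \<Rightarrow> 'a set"
  where "iota G z = preceq_equiv G `` {z}"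

abbreviation iotaX :: "('p, 'a) polarity \<Rightarrow> 'a \<Rightarrow> 'a set"
  where "iotaX G \<equiv> iota G"

abbreviation iotaY :: "('p, 'a) polarity \<Rightarrow> 'a \<Rightarrow> 'a set"
  where "iotaY G \<equiv> iota G"

definition gam :: "('p, 'a) polarity \<Rightarrow> 'p \<Rightarrow> 'a set"
  where "gam G = iotaX G \<circ> embX G"

definition polarity_morphism ::
  "('p, 'a) polarity \<Rightarrow> ('q, 'b) polarity \<Rightarrow> ('a \<Rightarrow> 'b) \<Rightarrow> ('p \<Rightarrow> 'q) \<Rightarrow> ('a \<Rightarrow> 'b) \<Rightarrow> bool"
  where "polarity_morphism G G' hX hP hY \<longleftrightarrow>
    order_preserving (polX G) (polX G') hX \<and>
    order_preserving (polP G) (polP G') hP \<and>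
    order_preserving (polY G) (polY G') hY \<and>
    \<comment> \<open>(M1)\<close>
    (\<forall>p\<in>carrier (polP G). hX (embX G p) = embX G' (hP p) \<and> hY (embY G p) = embY G' (hP p)) \<and>
    \<comment> \<open>(M2)\<close>
    (\<forall>x\<in>carrier (polX G). \<forall>y\<in>carrier (polY G).
      iotaY G y \<sqsubseteq>\<^bsub>amalgam G\<^esub> iotaX G x \<longrightarrow>
      iotaY G' (hY y) \<sqsubseteq>\<^bsub>amalgam G'\<^esub> iotaX G' (hX x)) \<and>
    \<comment> \<open>(M3)\<close>
    (\<forall>x'\<in>carrier (polX G'). \<forall>y'\<in>carrier (polY G'). (x', y') \<notin> polR G' \<longrightarrow>
      (\<exists>x\<in>carrier (polX G). \<exists>y\<in>carrier (polY G).
        preimage (polX G) hX (up (polX G') x') \<subseteq> up (polX G) x \<and>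
        preimage (polY G) hY (down (polY G') y') \<subseteq> down (polY G) y \<and>
        (\<forall>a\<in>carrier (polX G). (hX a, y') \<in> polR G' \<longrightarrow> (a, y) \<in> polR G) \<and>
        (\<forall>b\<in>carrier (polY G). (x', hY b) \<in> polR G' \<longrightarrow> (x, b) \<in> polR G) \<and>
        (x, y) \<notin> polR G))"

definition polarity_embedding ::
  "('p, 'a) polarity \<Rightarrow> ('q, 'b) polarity \<Rightarrow> ('a \<Rightarrow> 'b) \<Rightarrow> ('p \<Rightarrow> 'q) \<Rightarrow> ('a \<Rightarrow> 'b) \<Rightarrow> bool"
  where "polarity_embedding G G' hX hP hY \<longleftrightarrow>
    polarity_morphism G G' hX hP hY \<and>
    order_embedding (polX G) (polX G') hX \<and>
    order_embedding (polP G) (polP G') hP \<and>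
    order_embedding (polY G) (polY G') hY \<and>
    (\<forall>x\<in>carrier (polX G). \<forall>y\<in>carrier (polY G). (hX x, hY y) \<in> polR G' \<longrightarrow> (x, y) \<in> polR G)"

definition galois_stable ::
  "('p, 'a) polarity \<Rightarrow> ('q, 'b) polarity \<Rightarrow> ('a set \<Rightarrow> 'b set) \<Rightarrow> bool"
  where "galois_stable G G' \<psi> \<longleftrightarrow>
    order_preserving (amalgam G) (amalgam G') \<psi> \<and>
    cut_stable (amalgam G) (amalgam G') \<psi> \<and>
    (\<psi> \<circ> gam G) ` carrier (polP G) \<subseteq> gam G' ` carrier (polP G') \<and>
    (\<psi> \<circ> iotaX G) ` carrier (polX G) \<subseteq> iotaX G' ` carrier (polX G') \<and>
    (\<psi> \<circ> iotaY G) ` carrier (polY G) \<subseteq> iotaY G' ` carrier (polY G')"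

text \<open>
  The assignment defining \<open>\<psi>\<^sub>h\<close> is given as a relation, so that well-definedness is the
  statement that it is single-valued and total on \<open>X \<uplus> Y\<close>; \<open>psi\<close> is the function it
  determines, extended by \<^const>\<open>undefined\<close> outside \<open>X \<uplus> Y\<close>.
\<close>

definition psi_graph ::
  "('p, 'a) polarity \<Rightarrow> ('q, 'b) polarity \<Rightarrow> ('a \<Rightarrow> 'b) \<Rightarrow> ('a \<Rightarrow> 'b) \<Rightarrow> ('a set \<times> 'b set) set"
  where "psi_graph G G' hX hY =
    {(iotaX G x, iotaX G' (hX x)) | x. x \<in> carrier (polX G)} \<union>
    {(iotaY G y, iotaY G' (hY y)) | y. y \<in> carrier (polY G)}"

definition psi ::
  "('p, 'a) polarity \<Rightarrow> ('q, 'b) polarity \<Rightarrow> ('a \<Rightarrow> 'b) \<Rightarrow> ('a \<Rightarrow> 'b) \<Rightarrow> 'a set \<Rightarrow> 'b set"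
  where "psi G G' hX hY =
    (\<lambda>c\<in>carrier (amalgam G). THE d. (c, d) \<in> psi_graph G G' hX hY)"

definition commutes_with ::
  "('p, 'a) polarity \<Rightarrow> ('q, 'b) polarity \<Rightarrow> ('a \<Rightarrow> 'b) \<Rightarrow> ('p \<Rightarrow> 'q) \<Rightarrow> ('a \<Rightarrow> 'b) \<Rightarrow>
    ('a set \<Rightarrow> 'b set) \<Rightarrow> bool"
  where "commutes_with G G' hX hP hY \<psi> \<longleftrightarrow>
    (\<forall>x\<in>carrier (polX G). \<psi> (iotaX G x) = iotaX G' (hX x)) \<and>
    (\<forall>y\<in>carrier (polY G). \<psi> (iotaY G y) = iotaY G' (hY y)) \<and>
    (\<forall>p\<in>carrier (polP G). \<psi> (gam G p) = gam G' (hP p))"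

end

theory Submission
  imports Defs
begin

text \<open>
  On representatives, \<open>\<psi>\<^sub>h\<close> is the map \<open>h\<close> acting as \<open>h\<^sub>X\<close> on \<open>X\<close> and as \<open>h\<^sub>Y\<close> on \<open>Y\<close>, so
  everything reduces to the preorder \<open>\<preceq>\<close> on \<open>X \<union> Y\<close>. The map \<open>h\<close> preserves \<open>\<preceq>\<close>: on \<open>Y \<times> X\<close> this is
  (M2), and on \<open>X \<times> Y\<close> a failure of \<open>h\<^sub>X x R' h\<^sub>Y y\<close> would by (M3) yield \<open>a \<in> X\<close>, \<open>b \<in> Y\<close> with
  \<open>a \<le> x R y \<le> b\<close> but not \<open>a R b\<close>. For cut-stability, if \<open>b\<^sub>1 \<le> b\<^sub>2\<close> fails in \<open>X' \<uplus> Y'\<close>, it is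
  witnessed by some \<open>x' \<le> b\<^sub>1\<close> and \<open>y' \<ge> b\<^sub>2\<close> with \<open>(x', y') \<notin> R'\<close>, because \<open>P'\<close> is meet-dense in \<open>X'\<close>
  and join-dense in \<open>Y'\<close>; (M3) at \<open>(x', y')\<close> provides the required cut.
\<close>

lemma order_embeddingI:
  assumes "order_preserving A B f"
    and "\<And>x y. x \<in> carrier A \<Longrightarrow> y \<in> carrier A \<Longrightarrow> f x \<sqsubseteq>\<^bsub>B\<^esub> f y \<Longrightarrow> x \<sqsubseteq>\<^bsub>A\<^esub> y"
  shows "order_embedding A B f"
  using assms by (auto simp: order_preserving_def isotone_def order_embedding_def order_emb_def)

section \<open>The poset of a Galois polarity\<close>

context galois_polarity
begin

abbreviation (input) "P \<equiv> carrier (polP G)"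
abbreviation (input) "X \<equiv> carrier (polX G)"
abbreviation (input) "Y \<equiv> carrier (polY G)"

section \<open>Posets, embeddings and density of \<open>P\<close>\<close>

lemma posets: "partial_order (polP G)" "partial_order (polX G)" "partial_order (polY G)"
  and disjoint: "X \<inter> Y = {}"
  and R_sub: "polR G \<subseteq> X \<times> Y"
  using extension_polarity by (auto simp: extension_polarity_def)

sublocale P: partial_order "polP G" by (rule posets)
sublocale X: partial_order "polX G" by (rule posets)
sublocale Y: partial_order "polY G" by (rule posets)

lemma embX_closed: "p \<in> P \<Longrightarrow> embX G p \<in> X"
  and embY_closed: "p \<in> P \<Longrightarrow> embY G p \<in> Y"
  and embX_le_iff: "p \<in> P \<Longrightarrow> q \<in> P \<Longrightarrow> embX G p \<sqsubseteq>\<^bsub>polX G\<^esub> embX G q \<longleftrightarrow> p \<sqsubseteq>\<^bsub>polP G\<^esub> q"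
  and embY_le_iff: "p \<in> P \<Longrightarrow> q \<in> P \<Longrightarrow> embY G p \<sqsubseteq>\<^bsub>polY G\<^esub> embY G q \<longleftrightarrow> p \<sqsubseteq>\<^bsub>polP G\<^esub> q"
  using extension_polarity
  by (auto simp: extension_polarity_def order_embedding_def order_emb_def)

lemma X_glb: "x \<in> X \<Longrightarrow> is_glb (polX G) x (embX G ` {q \<in> P. x \<sqsubseteq>\<^bsub>polX G\<^esub> embX G q})"
proof -
  assume x: "x \<in> X"
  have eq: "preimage (polP G) (embX G) (up (polX G) x) = {q \<in> P. x \<sqsubseteq>\<^bsub>polX G\<^esub> embX G q}"
    by (auto simp: preimage_def up_def embX_closed)
  show ?thesis using x meet_ext unfolding meet_extension_def eq[symmetric] by blast
qed

lemma Y_lub: "y \<in> Y \<Longrightarrow> is_lub (polY G) y (embY G ` {q \<in> P. embY G q \<sqsubseteq>\<^bsub>polY G\<^esub> y})"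
proof -
  assume y: "y \<in> Y"
  have eq: "preimage (polP G) (embY G) (down (polY G) y) = {q \<in> P. embY G q \<sqsubseteq>\<^bsub>polY G\<^esub> y}"
    by (auto simp: preimage_def down_def embY_closed)
  show ?thesis using y join_ext unfolding join_extension_def eq[symmetric] by blast
qed

lemma X_leI:
  assumes "x1 \<in> X" "x2 \<in> X"
    and "\<And>q. q \<in> P \<Longrightarrow> x2 \<sqsubseteq>\<^bsub>polX G\<^esub> embX G q \<Longrightarrow> x1 \<sqsubseteq>\<^bsub>polX G\<^esub> embX G q"
  shows "x1 \<sqsubseteq>\<^bsub>polX G\<^esub> x2"
  by (rule greatest_le[OF X_glb[OF assms(2)]]) (use assms in \<open>auto simp: Lower_def\<close>)

text \<open>Dual argument by join-density: \<open>y2\<close> is an upper bound of the set whose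
  least upper bound is \<open>y1\<close>.\<close>

lemma Y_leI:
  assumes "y1 \<in> Y" "y2 \<in> Y"
    and "\<And>p. p \<in> P \<Longrightarrow> embY G p \<sqsubseteq>\<^bsub>polY G\<^esub> y1 \<Longrightarrow> embY G p \<sqsubseteq>\<^bsub>polY G\<^esub> y2"
  shows "y1 \<sqsubseteq>\<^bsub>polY G\<^esub> y2"
  by (rule least_le[OF Y_lub[OF assms(1)]]) (use assms in \<open>auto simp: Upper_def\<close>)

section \<open>The preorder on X \<union> Y\<close>

lemma preceq_XX: "x1 \<in> X \<Longrightarrow> x2 \<in> X \<Longrightarrow> (x1, x2) \<in> preceq G \<longleftrightarrow> x1 \<sqsubseteq>\<^bsub>polX G\<^esub> x2"
  and preceq_YY: "y1 \<in> Y \<Longrightarrow> y2 \<in> Y \<Longrightarrow> (y1, y2) \<in> preceq G \<longleftrightarrow> y1 \<sqsubseteq>\<^bsub>polY G\<^esub> y2"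
  and preceq_XY: "x \<in> X \<Longrightarrow> y \<in> Y \<Longrightarrow> (x, y) \<in> preceq G \<longleftrightarrow> (x, y) \<in> polR G"
  and preceq_YX: "x \<in> X \<Longrightarrow> y \<in> Y \<Longrightarrow> (y, x) \<in> preceq G \<longleftrightarrow>
    (\<forall>p\<in>P. \<forall>q\<in>P. embY G p \<sqsubseteq>\<^bsub>polY G\<^esub> y \<and> x \<sqsubseteq>\<^bsub>polX G\<^esub> embX G q \<longrightarrow> p \<sqsubseteq>\<^bsub>polP G\<^esub> q)"
  using disjoint R_sub unfolding preceq_def by blast+

lemmas preceq_simps = preceq_XX preceq_YY preceq_XY preceq_YX

lemma preceq_closed: "preceq G \<subseteq> (X \<union> Y) \<times> (X \<union> Y)"
  using R_sub by (auto simp: preceq_def)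

lemma preceq_refl: "z \<in> X \<union> Y \<Longrightarrow> (z, z) \<in> preceq G"
  by (auto simp: preceq_simps)

text \<open>The path X to Y to X is one of the two hard cases of transitivity. Since
  \<open>y\<close> is the join of the copies of \<open>P\<close> below it, (C8) reduces the claim to
  comparing \<open>embX G q\<close> with \<open>x2\<close> for each such copy
  \<open>embY G q\<close>.\<close>

lemma R_YX_trans:
  assumes "x1 \<in> X" "y \<in> Y" "x2 \<in> X" "(x1, y) \<in> polR G" "(y, x2) \<in> preceq G"
  shows "x1 \<sqsubseteq>\<^bsub>polX G\<^esub> x2"
proof (rule C8[OF _ assms(2,1,3) Y_lub[OF assms(2)] assms(4)])
  fix q assume q: "q \<in> {q \<in> P. embY G q \<sqsubseteq>\<^bsub>polY G\<^esub> y}"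
  show "embX G q \<sqsubseteq>\<^bsub>polX G\<^esub> x2"
    \<comment> \<open>For a test element \<open>embX G r\<close> above \<open>x2\<close>, the Y-to-X
      clause of \<open>preceq\<close>, applied to \<open>embY G q\<close> below \<open>y\<close>,
      gives q \<le> r.\<close>
    by (rule X_leI) (use assms q in \<open>auto simp: embX_closed embX_le_iff preceq_YX\<close>)
qed auto

text \<open>The dual hard case, by (C7), with \<open>x\<close> written as the meet of the copies of
  \<open>P\<close> above it.\<close>

lemma YX_R_trans:
  assumes "y1 \<in> Y" "x \<in> X" "y2 \<in> Y" "(y1, x) \<in> preceq G" "(x, y2) \<in> polR G"
  shows "y1 \<sqsubseteq>\<^bsub>polY G\<^esub> y2"
proof (rule C7[OF _ assms(2,1,3) X_glb[OF assms(2)] assms(5)])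
  fix q assume q: "q \<in> {q \<in> P. x \<sqsubseteq>\<^bsub>polX G\<^esub> embX G q}"
  show "y1 \<sqsubseteq>\<^bsub>polY G\<^esub> embY G q"
    by (rule Y_leI) (use assms q in \<open>auto simp: embY_closed embY_le_iff preceq_YX\<close>)
qed auto

lemma preceq_trans:
  assumes "(u, v) \<in> preceq G" "(v, w) \<in> preceq G"
  shows "(u, w) \<in> preceq G"
proof -
  have uvw: "u \<in> X \<union> Y" "v \<in> X \<union> Y" "w \<in> X \<union> Y" using assms preceq_closed by auto
  consider "u \<in> X" "v \<in> X" "w \<in> X" | "u \<in> X" "v \<in> X" "w \<in> Y" | "u \<in> X" "v \<in> Y" "w \<in> X"
    | "u \<in> X" "v \<in> Y" "w \<in> Y" | "u \<in> Y" "v \<in> X" "w \<in> X" | "u \<in> Y" "v \<in> X" "w \<in> Y"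
    | "u \<in> Y" "v \<in> Y" "w \<in> X" | "u \<in> Y" "v \<in> Y" "w \<in> Y" using uvw by blast
  then show ?thesis
  proof cases
    case 1 with assms show ?thesis by (metis preceq_XX X.le_trans)
  next
    case 2 with assms show ?thesis by (metis preceq_XX preceq_XY C1)
  next
    case 3 with assms show ?thesis by (metis preceq_XX preceq_XY R_YX_trans)
  next
    case 4 with assms show ?thesis by (metis preceq_YY preceq_XY C2)
  next
    case 5 with assms show ?thesis
      \<comment> \<open>Every \<open>embX G q\<close> above \<open>w\<close> is also above
        \<open>v\<close>, so the condition for \<open>(u, w)\<close> is an instance of the one for
        \<open>(u, v)\<close>. Case 7 is dual.\<close>
      by (simp add: preceq_simps) (metis X.le_trans embX_closed)
  next
    case 6 with assms show ?thesis by (metis preceq_YY preceq_XY YX_R_trans)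
  next
    case 7 with assms show ?thesis
      by (simp add: preceq_simps) (metis Y.le_trans embY_closed)
  next
    case 8 with assms show ?thesis by (metis preceq_YY Y.le_trans)
  qed
qed

section \<open>The quotient poset\<close>

lemma equiv_preceq_equiv: "equiv (X \<union> Y) (preceq_equiv G)"
proof (rule equivI)
  show "preceq_equiv G \<subseteq> (X \<union> Y) \<times> (X \<union> Y)"
    using preceq_closed by (auto simp: preceq_equiv_def)
  show "refl_on (X \<union> Y) (preceq_equiv G)"
    using preceq_refl by (auto simp: preceq_equiv_def refl_on_def)
  show "sym (preceq_equiv G)" by (auto simp: preceq_equiv_def sym_def)
  show "trans (preceq_equiv G)"
    using preceq_trans by (auto simp: preceq_equiv_def intro!: transI)
qed

lemma carrier_amalgam: "carrier (amalgam G) = iota G ` (X \<union> Y)"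
  by (auto simp: amalgam_def iota_def quotient_def)

lemma iota_closed: "z \<in> X \<union> Y \<Longrightarrow> iota G z \<in> carrier (amalgam G)"
  by (auto simp: carrier_amalgam)

lemma amalgam_cases:
  assumes "c \<in> carrier (amalgam G)"
  obtains z where "z \<in> X \<union> Y" "c = iota G z"
  using assms unfolding carrier_amalgam by blast

lemma iota_le_iff:
  assumes "z \<in> X \<union> Y" "w \<in> X \<union> Y"
  shows "iota G z \<sqsubseteq>\<^bsub>amalgam G\<^esub> iota G w \<longleftrightarrow> (z, w) \<in> preceq G"
proof
  assume "iota G z \<sqsubseteq>\<^bsub>amalgam G\<^esub> iota G w"
  \<comment> \<open>The order on classes only provides some related representatives; equivalence
    links them to the given ones at both ends.\<close>
  then obtain z' w' where "(z, z') \<in> preceq G" "(z', w') \<in> preceq G" "(w', w) \<in> preceq G"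
    by (auto simp: amalgam_def iota_def preceq_equiv_def)
  then show "(z, w) \<in> preceq G" by (metis preceq_trans)
next
  assume "(z, w) \<in> preceq G"
  then show "iota G z \<sqsubseteq>\<^bsub>amalgam G\<^esub> iota G w"
    using preceq_refl[OF assms(1)] preceq_refl[OF assms(2)]
    by (auto simp: amalgam_def iota_def preceq_equiv_def)
qed

lemma iota_eq_iff:
  assumes "z \<in> X \<union> Y" "w \<in> X \<union> Y"
  shows "iota G z = iota G w \<longleftrightarrow> (z, w) \<in> preceq G \<and> (w, z) \<in> preceq G"
  using eq_equiv_class_iff[OF equiv_preceq_equiv assms]
  by (simp add: iota_def preceq_equiv_def)

text \<open>Needed because \<open>isotone\<close> includes the requirement that both structures be
  weak partial orders.\<close>

lemma partial_order_amalgam: "partial_order (amalgam G)"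
proof -
  have eq: "(.=\<^bsub>amalgam G\<^esub>) = (=)" by (simp add: amalgam_def)
  show ?thesis
  proof (unfold_locales, unfold eq)
    fix a assume "a \<in> carrier (amalgam G)"
    then show "a \<sqsubseteq>\<^bsub>amalgam G\<^esub> a"
      unfolding carrier_amalgam by (auto simp: iota_le_iff preceq_refl)
  next
    fix a b assume "a \<in> carrier (amalgam G)" "b \<in> carrier (amalgam G)"
      and "a \<sqsubseteq>\<^bsub>amalgam G\<^esub> b" "b \<sqsubseteq>\<^bsub>amalgam G\<^esub> a"
    then show "a = b"
      by (elim amalgam_cases) (simp add: iota_le_iff iota_eq_iff)
  next
    fix a b c assume "a \<in> carrier (amalgam G)" "b \<in> carrier (amalgam G)" "c \<in> carrier (amalgam G)"
      and "a \<sqsubseteq>\<^bsub>amalgam G\<^esub> b" "b \<sqsubseteq>\<^bsub>amalgam G\<^esub> c"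
    then show "a \<sqsubseteq>\<^bsub>amalgam G\<^esub> c"
      by (elim amalgam_cases) (metis iota_le_iff preceq_trans)
  qed auto
qed

section \<open>The two copies of \<open>P\<close>, and separation by pairs outside R\<close>

lemma emb_equiv:
  assumes "p \<in> P"
  shows "(embX G p, embY G p) \<in> preceq G" "(embY G p, embX G p) \<in> preceq G"
  \<comment> \<open>The first relation is (C3). For the second, elements a, b of \<open>P\<close>
    with \<open>embY G a\<close> below \<open>embY G p\<close> and \<open>embX G p\<close> below
    \<open>embX G b\<close> satisfy a \<le> p \<le> b.\<close>
  using assms
  by (auto simp: preceq_simps embX_closed embY_closed C3 embX_le_iff embY_le_iff
      intro: P.le_trans)

lemma emb_R_iff:
  assumes "p \<in> P" "q \<in> P"
  shows "(embX G p, embY G q) \<in> polR G \<longleftrightarrow> p \<sqsubseteq>\<^bsub>polP G\<^esub> q"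
proof -
  have "(embX G p, embY G q) \<in> preceq G \<longleftrightarrow> (embX G p, embX G q) \<in> preceq G"
    using emb_equiv[OF assms(2)] by (blast intro: preceq_trans)
  then show ?thesis using assms by (simp add: preceq_simps embX_closed embY_closed embX_le_iff)
qed

text \<open>Turns any failure of the preorder into a failure of R, which is the situation (M3)
  addresses. If \<open>z\<close> is in \<open>X\<close> it serves as \<open>x\<close>, and if
  \<open>w\<close> is in \<open>Y\<close> it serves as \<open>y\<close>; otherwise density supplies
  an element of \<open>P\<close>, whose copy is moved to the required side by
  \<open>emb_equiv\<close>.\<close>

lemma preceq_separation:
  assumes "z \<in> X \<union> Y" "w \<in> X \<union> Y" "(z, w) \<notin> preceq G"
  obtains x y where "x \<in> X" "y \<in> Y" "(x, z) \<in> preceq G" "(w, y) \<in> preceq G" "(x, y) \<notin> preceq G"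
proof -
  consider "z \<in> X" "w \<in> Y" | "z \<in> X" "w \<in> X" | "z \<in> Y" "w \<in> Y" | "z \<in> Y" "w \<in> X"
    using assms by blast
  then show thesis
  proof cases
    case 1
    with assms show thesis by (auto intro: that[of z w] preceq_refl)
  next
    case 2
    with assms obtain q where q: "q \<in> P" "w \<sqsubseteq>\<^bsub>polX G\<^esub> embX G q" "\<not> z \<sqsubseteq>\<^bsub>polX G\<^esub> embX G q"
      using X_leI[of z w] by (auto simp: preceq_XX)
    then have "(w, embX G q) \<in> preceq G" "(z, embX G q) \<notin> preceq G"
      using 2 by (auto simp: preceq_XX embX_closed)
    \<comment> \<open>The separating element must lie in \<open>Y\<close>, so
      \<open>embX G q\<close> is exchanged for its equivalent copy.\<close>
    then have "(w, embY G q) \<in> preceq G" "(z, embY G q) \<notin> preceq G"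
      using preceq_trans[OF _ emb_equiv(1)[OF q(1)]] preceq_trans[OF _ emb_equiv(2)[OF q(1)]] by blast+
    with 2 q show thesis by (auto intro: that[of z "embY G q"] preceq_refl embY_closed)
  next
    case 3
    with assms obtain p where p: "p \<in> P" "embY G p \<sqsubseteq>\<^bsub>polY G\<^esub> z" "\<not> embY G p \<sqsubseteq>\<^bsub>polY G\<^esub> w"
      using Y_leI[of z w] by (auto simp: preceq_YY)
    then have "(embY G p, z) \<in> preceq G" "(embY G p, w) \<notin> preceq G"
      using 3 by (auto simp: preceq_YY embY_closed)
    then have "(embX G p, z) \<in> preceq G" "(embX G p, w) \<notin> preceq G"
      using preceq_trans[OF emb_equiv(1)[OF p(1)]] preceq_trans[OF emb_equiv(2)[OF p(1)]] by blast+
    with 3 p show thesis by (auto intro: that[of "embX G p" w] preceq_refl embX_closed)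
  next
    case 4
    with assms obtain p q where pq: "p \<in> P" "q \<in> P" "embY G p \<sqsubseteq>\<^bsub>polY G\<^esub> z"
      "w \<sqsubseteq>\<^bsub>polX G\<^esub> embX G q" "\<not> p \<sqsubseteq>\<^bsub>polP G\<^esub> q"
      by (auto simp: preceq_YX)
    then have "(embY G p, z) \<in> preceq G" "(w, embX G q) \<in> preceq G"
      using 4 by (auto simp: preceq_simps embX_closed embY_closed)
    then have "(embX G p, z) \<in> preceq G" "(w, embY G q) \<in> preceq G"
      using preceq_trans[OF emb_equiv(1)[OF pq(1)]] preceq_trans[OF _ emb_equiv(1)[OF pq(2)]] by blast+
    \<comment> \<open>By \<open>emb_R_iff\<close>, the failure of p \<le> q is exactly the failure
      of R between the two chosen copies.\<close>
    then show thesis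
      using that[of "embX G p" "embY G q"] pq by (auto simp: preceq_XY embX_closed embY_closed emb_R_iff)
  qed
qed

end

section \<open>Polarity morphisms\<close>

locale galois_polarity_morphism =
  dom: galois_polarity G + cod: galois_polarity G'
  for G :: "('p, 'a) polarity" and G' :: "('q, 'b) polarity" +
  fixes hX :: "'a \<Rightarrow> 'b" and hP :: "'p \<Rightarrow> 'q" and hY :: "'a \<Rightarrow> 'b"
  assumes morphism: "polarity_morphism G G' hX hP hY"
begin

section \<open>The action on representatives\<close>

definition h :: "'a \<Rightarrow> 'b"
  where "h z = (if z \<in> dom.X then hX z else hY z)"

lemma h_X: "x \<in> dom.X \<Longrightarrow> h x = hX x"
  and h_Y: "y \<in> dom.Y \<Longrightarrow> h y = hY y"
  using dom.disjoint by (auto simp: h_def)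

lemma hX_closed: "x \<in> dom.X \<Longrightarrow> hX x \<in> cod.X"
  and hP_closed: "p \<in> dom.P \<Longrightarrow> hP p \<in> cod.P"
  and hY_closed: "y \<in> dom.Y \<Longrightarrow> hY y \<in> cod.Y"
  and hX_mono: "x1 \<in> dom.X \<Longrightarrow> x2 \<in> dom.X \<Longrightarrow> x1 \<sqsubseteq>\<^bsub>polX G\<^esub> x2 \<Longrightarrow> hX x1 \<sqsubseteq>\<^bsub>polX G'\<^esub> hX x2"
  and hY_mono: "y1 \<in> dom.Y \<Longrightarrow> y2 \<in> dom.Y \<Longrightarrow> y1 \<sqsubseteq>\<^bsub>polY G\<^esub> y2 \<Longrightarrow> hY y1 \<sqsubseteq>\<^bsub>polY G'\<^esub> hY y2"
  and hX_embX: "p \<in> dom.P \<Longrightarrow> hX (embX G p) = embX G' (hP p)"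
  and hY_embY: "p \<in> dom.P \<Longrightarrow> hY (embY G p) = embY G' (hP p)"
  using morphism by (auto simp: polarity_morphism_def order_preserving_def isotone_def)

lemma h_closed: "z \<in> dom.X \<union> dom.Y \<Longrightarrow> h z \<in> cod.X \<union> cod.Y"
  by (auto simp: h_def hX_closed hY_closed)

lemma M2:
  assumes "x \<in> dom.X" "y \<in> dom.Y" "(y, x) \<in> preceq G"
  shows "(hY y, hX x) \<in> preceq G'"
  using assms morphism
  by (simp add: polarity_morphism_def dom.iota_le_iff cod.iota_le_iff hX_closed hY_closed)

text \<open>On \<open>X\<close> the relation from \<open>x\<close> is the order of \<open>X\<close>,
  and on \<open>Y\<close> it is R, so clauses (i) and (iv) combine into one statement about
  \<open>preceq\<close>; clauses (ii) and (iii) combine in the same way for \<open>y\<close>. This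
  spares later arguments a case split on where \<open>z\<close> lies.\<close>

lemma M3:
  assumes "x' \<in> cod.X" "y' \<in> cod.Y" "(x', y') \<notin> preceq G'"
  obtains x y where "x \<in> dom.X" "y \<in> dom.Y" "(x, y) \<notin> preceq G"
    and "\<And>z. z \<in> dom.X \<union> dom.Y \<Longrightarrow> (x', h z) \<in> preceq G' \<Longrightarrow> (x, z) \<in> preceq G"
    and "\<And>z. z \<in> dom.X \<union> dom.Y \<Longrightarrow> (h z, y') \<in> preceq G' \<Longrightarrow> (z, y) \<in> preceq G"
proof -
  have "(x', y') \<notin> polR G'" using assms by (simp add: cod.preceq_XY)
  with assms(1,2) morphism obtain x y where xy: "x \<in> dom.X" "y \<in> dom.Y" "(x, y) \<notin> polR G"
    and i: "preimage (polX G) hX (up (polX G') x') \<subseteq> up (polX G) x"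
    and ii: "preimage (polY G) hY (down (polY G') y') \<subseteq> down (polY G) y"
    and iii: "\<forall>a\<in>dom.X. (hX a, y') \<in> polR G' \<longrightarrow> (a, y) \<in> polR G"
    and iv: "\<forall>b\<in>dom.Y. (x', hY b) \<in> polR G' \<longrightarrow> (x, b) \<in> polR G"
    unfolding polarity_morphism_def by blast
  show thesis
  proof (rule that[of x y])
    fix z assume z: "z \<in> dom.X \<union> dom.Y"
    show "(x', h z) \<in> preceq G' \<Longrightarrow> (x, z) \<in> preceq G"
      using z assms xy i iv
      by (auto simp: h_X h_Y dom.preceq_simps cod.preceq_simps hX_closed hY_closed
          preimage_def up_def)
    show "(h z, y') \<in> preceq G' \<Longrightarrow> (z, y) \<in> preceq G"
      using z assms xy ii iii
      by (auto simp: h_X h_Y dom.preceq_simps cod.preceq_simps hX_closed hY_closed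
          preimage_def down_def)
  qed (use xy in \<open>auto simp: dom.preceq_XY\<close>)
qed

lemma h_mono:
  assumes "(z, w) \<in> preceq G"
  shows "(h z, h w) \<in> preceq G'"
proof -
  have "z \<in> dom.X \<union> dom.Y" "w \<in> dom.X \<union> dom.Y" using assms dom.preceq_closed by auto
  then consider "z \<in> dom.X" "w \<in> dom.X" | "z \<in> dom.Y" "w \<in> dom.Y" | "z \<in> dom.Y" "w \<in> dom.X"
    | "z \<in> dom.X" "w \<in> dom.Y" by blast
  then show ?thesis
  proof cases
    case 1 with assms show ?thesis
      by (simp add: h_X hX_closed hX_mono dom.preceq_XX cod.preceq_XX)
  next
    case 2 with assms show ?thesis
      by (simp add: h_Y hY_closed hY_mono dom.preceq_YY cod.preceq_YY)
  next
    case 3 with assms show ?thesis by (simp add: h_X h_Y M2)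
  next
    case 4
    then have h': "h z \<in> cod.X" "h w \<in> cod.Y" by (simp_all add: h_X h_Y hX_closed hY_closed)
    show ?thesis
    proof (rule ccontr)
      assume "(h z, h w) \<notin> preceq G'"
      \<comment> \<open>(M3) is taken at \<open>h z\<close> and \<open>h w\<close> themselves;
        reflexivity there puts \<open>x\<close> below \<open>z\<close> and \<open>w\<close> below
        \<open>y\<close>.\<close>
      from M3[OF h' this] obtain x y where "(x, y) \<notin> preceq G" "(x, z) \<in> preceq G" "(w, y) \<in> preceq G"
        using 4 h' cod.preceq_refl by (metis UnCI)
      with assms show False by (blast intro: dom.preceq_trans)
    qed
  qed
qed

section \<open>Well-definedness and uniqueness of \<psi>\<close>

lemma psi_graph_eq: "psi_graph G G' hX hY = {(iota G z, iota G' (h z)) | z. z \<in> dom.X \<union> dom.Y}"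
  unfolding psi_graph_def by (auto simp: h_X h_Y)

lemma psi_graph_iota_iff:
  assumes "z \<in> dom.X \<union> dom.Y"
  shows "(iota G z, d) \<in> psi_graph G G' hX hY \<longleftrightarrow> d = iota G' (h z)"
proof
  assume "(iota G z, d) \<in> psi_graph G G' hX hY"
  then obtain w where "w \<in> dom.X \<union> dom.Y" "iota G z = iota G w" "d = iota G' (h w)"
    unfolding psi_graph_eq by blast
  \<comment> \<open>The class may have been entered through another representative \<open>w\<close>,
    even one on the other side. Since \<open>z\<close> and \<open>w\<close> are below each other,
    \<open>h_mono\<close> makes their images equivalent.\<close>
  with assms show "d = iota G' (h z)"
    by (simp add: dom.iota_eq_iff cod.iota_eq_iff h_closed h_mono del: Un_iff)
qed (use assms in \<open>auto simp: psi_graph_eq\<close>)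

abbreviation (input) "\<psi> \<equiv> psi G G' hX hY"

lemma psi_iota: "z \<in> dom.X \<union> dom.Y \<Longrightarrow> \<psi> (iota G z) = iota G' (h z)"
  by (simp add: psi_def dom.iota_closed psi_graph_iota_iff)

lemma psi_closed: "\<psi> \<in> carrier (amalgam G) \<rightarrow>\<^sub>E carrier (amalgam G')"
proof (rule PiE_I)
  fix c assume "c \<in> carrier (amalgam G)"
  then show "\<psi> c \<in> carrier (amalgam G')"
    by (elim dom.amalgam_cases) (simp add: psi_iota cod.iota_closed h_closed del: Un_iff)
qed (simp add: psi_def)

lemma psi_graph_functional: "c \<in> carrier (amalgam G) \<Longrightarrow> \<exists>!d. (c, d) \<in> psi_graph G G' hX hY"
  by (elim dom.amalgam_cases) (simp add: psi_graph_iota_iff)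

lemma psi_commutes: "commutes_with G G' hX hP hY \<psi>"
  by (auto simp: commutes_with_def psi_iota h_X h_Y gam_def hX_embX dom.embX_closed)

text \<open>Every class has a representative in \<open>X\<close> or \<open>Y\<close>, where the
  value is prescribed. Outside the carrier both maps are \<open>undefined\<close> by extensionality,
  so they are equal as functions.\<close>

lemma psi_unique:
  assumes "\<phi> \<in> carrier (amalgam G) \<rightarrow>\<^sub>E carrier (amalgam G')" "commutes_with G G' hX hP hY \<phi>"
  shows "\<phi> = \<psi>"
proof (rule PiE_ext[OF assms(1) psi_closed])
  fix c assume "c \<in> carrier (amalgam G)"
  then show "\<phi> c = \<psi> c"
    using assms(2) psi_commutes by (elim dom.amalgam_cases) (auto simp: commutes_with_def)
qed

section \<open>Galois-stability\<close>

lemma psi_le_iff: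
  assumes "z \<in> dom.X \<union> dom.Y" "w \<in> dom.X \<union> dom.Y"
  shows "\<psi> (iota G z) \<sqsubseteq>\<^bsub>amalgam G'\<^esub> \<psi> (iota G w) \<longleftrightarrow> (h z, h w) \<in> preceq G'"
  using assms by (simp add: psi_iota cod.iota_le_iff h_closed del: Un_iff)

lemma psi_order_preserving: "order_preserving (amalgam G) (amalgam G') \<psi>"
  unfolding order_preserving_def
proof
  show "isotone (amalgam G) (amalgam G') \<psi>"
  proof (rule isotoneI)
    show "weak_partial_order (amalgam G)" "weak_partial_order (amalgam G')"
      using dom.partial_order_amalgam cod.partial_order_amalgam
      by (auto simp: partial_order_def)
    fix c d assume "c \<in> carrier (amalgam G)" "d \<in> carrier (amalgam G)" "c \<sqsubseteq>\<^bsub>amalgam G\<^esub> d"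
    then show "\<psi> c \<sqsubseteq>\<^bsub>amalgam G'\<^esub> \<psi> d"
      by (elim dom.amalgam_cases) (simp add: dom.iota_le_iff psi_le_iff h_mono)
  qed
qed (use psi_closed in auto)

lemma psi_cut_stable: "cut_stable (amalgam G) (amalgam G') \<psi>"
  unfolding cut_stable_def
proof (intro conjI psi_order_preserving ballI impI)
  fix b1 b2 assume "b1 \<in> carrier (amalgam G')" "b2 \<in> carrier (amalgam G')"
    and nle: "\<not> b1 \<sqsubseteq>\<^bsub>amalgam G'\<^esub> b2"
  then obtain z' w' where z': "z' \<in> cod.X \<union> cod.Y" "b1 = iota G' z'"
    and w': "w' \<in> cod.X \<union> cod.Y" "b2 = iota G' w'"
    by (elim cod.amalgam_cases)
  with nle have "(z', w') \<notin> preceq G'" by (simp add: cod.iota_le_iff)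
  with z' w' obtain x' y' where x': "x' \<in> cod.X" "(x', z') \<in> preceq G'"
    and y': "y' \<in> cod.Y" "(w', y') \<in> preceq G'" and n': "(x', y') \<notin> preceq G'"
    using cod.preceq_separation by metis
  obtain x y where xy: "x \<in> dom.X" "y \<in> dom.Y" "(x, y) \<notin> preceq G"
    and up: "\<And>z. z \<in> dom.X \<union> dom.Y \<Longrightarrow> (x', h z) \<in> preceq G' \<Longrightarrow> (x, z) \<in> preceq G"
    and dn: "\<And>z. z \<in> dom.X \<union> dom.Y \<Longrightarrow> (h z, y') \<in> preceq G' \<Longrightarrow> (z, y) \<in> preceq G"
    using M3[OF x'(1) y'(1) n'] by blast
  show "\<exists>a1\<in>carrier (amalgam G). \<exists>a2\<in>carrier (amalgam G). \<not> a1 \<sqsubseteq>\<^bsub>amalgam G\<^esub> a2 \<and>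
      preimage (amalgam G) \<psi> (up (amalgam G') b1) \<subseteq> up (amalgam G) a1 \<and>
      preimage (amalgam G) \<psi> (down (amalgam G') b2) \<subseteq> down (amalgam G) a2"
  proof (intro bexI conjI subsetI)
    \<comment> \<open>The classes of the pair supplied by (M3) form the cut.\<close>
    show "\<not> iota G x \<sqsubseteq>\<^bsub>amalgam G\<^esub> iota G y" using xy by (simp add: dom.iota_le_iff)
    show "iota G x \<in> carrier (amalgam G)" "iota G y \<in> carrier (amalgam G)"
      using xy by (auto intro: dom.iota_closed)
  next
    fix c assume c: "c \<in> preimage (amalgam G) \<psi> (up (amalgam G') b1)"
    then obtain z where z: "z \<in> dom.X \<union> dom.Y" "c = iota G z"
      by (auto simp: preimage_def dom.carrier_amalgam)
    with c z' have "(z', h z) \<in> preceq G'"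
      by (simp add: preimage_def up_def psi_iota cod.iota_le_iff h_closed del: Un_iff)
    \<comment> \<open>Chain \<open>x'\<close> \<preceq> \<open>z'\<close> \<preceq>
      \<open>h z\<close>: passing to the smaller \<open>x'\<close> only enlarges the set of elements
      above it.\<close>
    with x' have "(x', h z) \<in> preceq G'" by (blast intro: cod.preceq_trans)
    with z up xy show "c \<in> up (amalgam G) (iota G x)"
      by (simp add: up_def dom.iota_closed dom.iota_le_iff)
  next
    fix c assume c: "c \<in> preimage (amalgam G) \<psi> (down (amalgam G') b2)"
    then obtain z where z: "z \<in> dom.X \<union> dom.Y" "c = iota G z"
      by (auto simp: preimage_def dom.carrier_amalgam)
    with c w' have "(h z, w') \<in> preceq G'"
      by (simp add: preimage_def down_def psi_iota cod.iota_le_iff h_closed del: Un_iff)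
    with y' have "(h z, y') \<in> preceq G'" by (blast intro: cod.preceq_trans)
    with z dn xy show "c \<in> down (amalgam G) (iota G y)"
      by (simp add: down_def dom.iota_closed dom.iota_le_iff)
  qed
qed

lemma psi_galois_stable: "galois_stable G G' \<psi>"
  unfolding galois_stable_def image_subset_iff comp_def
  using psi_commutes[unfolded commutes_with_def]
  by (simp add: psi_order_preserving psi_cut_stable hX_closed hP_closed hY_closed)

lemma psi_embedding_iff_reflects:

  \<comment> \<open>Embeddings and surjectivity\<close>
  "order_embedding (amalgam G) (amalgam G') \<psi> \<longleftrightarrow>
    (\<forall>z\<in>dom.X \<union> dom.Y. \<forall>w\<in>dom.X \<union> dom.Y. (h z, h w) \<in> preceq G' \<longrightarrow> (z, w) \<in> preceq G)"
proof -
  have "order_embedding (amalgam G) (amalgam G') \<psi> \<longleftrightarrow>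
    (\<forall>c\<in>carrier (amalgam G). \<forall>d\<in>carrier (amalgam G).
      \<psi> c \<sqsubseteq>\<^bsub>amalgam G'\<^esub> \<psi> d \<longleftrightarrow> c \<sqsubseteq>\<^bsub>amalgam G\<^esub> d)"
    using psi_order_preserving
    by (auto simp: order_embedding_def order_preserving_def order_emb_def isotone_def)
  also have "\<dots> \<longleftrightarrow> (\<forall>z\<in>dom.X \<union> dom.Y. \<forall>w\<in>dom.X \<union> dom.Y.
      (h z, h w) \<in> preceq G' \<longleftrightarrow> (z, w) \<in> preceq G)"
    unfolding dom.carrier_amalgam by (simp add: psi_le_iff dom.iota_le_iff del: Un_iff)
  finally show ?thesis using h_mono by blast
qed

lemma reflects_if_polarity_embedding:
  assumes emb: "polarity_embedding G G' hX hP hY"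
    and zw: "z \<in> dom.X \<union> dom.Y" "w \<in> dom.X \<union> dom.Y" "(h z, h w) \<in> preceq G'"
  shows "(z, w) \<in> preceq G"
proof -
  have X_refl: "x1 \<sqsubseteq>\<^bsub>polX G\<^esub> x2"
    if "x1 \<in> dom.X" "x2 \<in> dom.X" "hX x1 \<sqsubseteq>\<^bsub>polX G'\<^esub> hX x2" for x1 x2
    using emb that by (auto simp: polarity_embedding_def order_embedding_def order_emb_def)
  have P_refl: "p \<sqsubseteq>\<^bsub>polP G\<^esub> q"
    if "p \<in> dom.P" "q \<in> dom.P" "hP p \<sqsubseteq>\<^bsub>polP G'\<^esub> hP q" for p q
    using emb that by (auto simp: polarity_embedding_def order_embedding_def order_emb_def)
  have Y_refl: "y1 \<sqsubseteq>\<^bsub>polY G\<^esub> y2"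
    if "y1 \<in> dom.Y" "y2 \<in> dom.Y" "hY y1 \<sqsubseteq>\<^bsub>polY G'\<^esub> hY y2" for y1 y2
    using emb that by (auto simp: polarity_embedding_def order_embedding_def order_emb_def)
  consider "z \<in> dom.X" "w \<in> dom.X" | "z \<in> dom.Y" "w \<in> dom.Y" | "z \<in> dom.X" "w \<in> dom.Y"
    | "z \<in> dom.Y" "w \<in> dom.X" using zw by blast
  then show ?thesis
  proof cases
    case 1 with zw X_refl show ?thesis
      by (simp add: h_X hX_closed dom.preceq_XX cod.preceq_XX)
  next
    case 2 with zw Y_refl show ?thesis
      by (simp add: h_Y hY_closed dom.preceq_YY cod.preceq_YY)
  next
    case 3 with zw emb show ?thesis
      by (simp add: polarity_embedding_def h_X h_Y hX_closed hY_closed dom.preceq_XY cod.preceq_XY)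
  next
    case 4
    \<comment> \<open>The Y-to-X relation is defined through \<open>P\<close>, so reflecting it
      comes down to \<open>hP\<close> reflecting order: the hypotheses on \<open>p\<close> and
      \<open>q\<close> are transported by \<open>hY\<close> and \<open>hX\<close>, and the same
      clause in \<open>G'\<close> compares \<open>hP p\<close> with \<open>hP q\<close>.\<close>
    have "p \<sqsubseteq>\<^bsub>polP G\<^esub> q" if pq: "p \<in> dom.P" "q \<in> dom.P"
      and le: "embY G p \<sqsubseteq>\<^bsub>polY G\<^esub> z" "w \<sqsubseteq>\<^bsub>polX G\<^esub> embX G q" for p q
    proof (rule P_refl[OF pq])
      have "hY (embY G p) \<sqsubseteq>\<^bsub>polY G'\<^esub> hY z" "hX w \<sqsubseteq>\<^bsub>polX G'\<^esub> hX (embX G q)"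
        using 4 pq le by (auto intro: hX_mono hY_mono dom.embX_closed dom.embY_closed)
      moreover have "(hY z, hX w) \<in> preceq G'" using 4 zw by (simp add: h_X h_Y)
      ultimately show "hP p \<sqsubseteq>\<^bsub>polP G'\<^esub> hP q"
        using 4 pq by (simp add: cod.preceq_YX hX_closed hY_closed hX_embX hY_embY hP_closed)
    qed
    with 4 show ?thesis by (simp add: dom.preceq_YX)
  qed
qed

lemma polarity_embedding_if_reflects:
  assumes refl: "\<And>z w. z \<in> dom.X \<union> dom.Y \<Longrightarrow> w \<in> dom.X \<union> dom.Y \<Longrightarrow>
    (h z, h w) \<in> preceq G' \<Longrightarrow> (z, w) \<in> preceq G"
  shows "polarity_embedding G G' hX hP hY"
proof -
  have X_refl: "x1 \<sqsubseteq>\<^bsub>polX G\<^esub> x2"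
    if "x1 \<in> dom.X" "x2 \<in> dom.X" "hX x1 \<sqsubseteq>\<^bsub>polX G'\<^esub> hX x2" for x1 x2
    using refl[of x1 x2] that by (simp add: h_X hX_closed dom.preceq_XX cod.preceq_XX)
  have Y_refl: "y1 \<sqsubseteq>\<^bsub>polY G\<^esub> y2"
    if "y1 \<in> dom.Y" "y2 \<in> dom.Y" "hY y1 \<sqsubseteq>\<^bsub>polY G'\<^esub> hY y2" for y1 y2
    using refl[of y1 y2] that by (simp add: h_Y hY_closed dom.preceq_YY cod.preceq_YY)
  have P_refl: "p \<sqsubseteq>\<^bsub>polP G\<^esub> q"
    if "p \<in> dom.P" "q \<in> dom.P" "hP p \<sqsubseteq>\<^bsub>polP G'\<^esub> hP q" for p q
    \<comment> \<open>By (M1), \<open>hX\<close> restricted to the copy of \<open>P\<close> is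
      \<open>hP\<close>, so it passes its reflection of order on to \<open>hP\<close>.\<close>
    using X_refl[of "embX G p" "embX G q"] that
    by (simp add: hX_embX hP_closed dom.embX_closed dom.embX_le_iff cod.embX_le_iff)
  have R_refl: "(x, y) \<in> polR G"
    if "x \<in> dom.X" "y \<in> dom.Y" "(hX x, hY y) \<in> polR G'" for x y
    using refl[of x y] that
    by (simp add: h_X h_Y hX_closed hY_closed dom.preceq_XY cod.preceq_XY)
  show ?thesis
    unfolding polarity_embedding_def
  proof (intro conjI ballI impI morphism)
    show "order_embedding (polX G) (polX G') hX" "order_embedding (polP G) (polP G') hP"
      "order_embedding (polY G) (polY G') hY"
      using morphism X_refl P_refl Y_refl
      by (auto simp: polarity_morphism_def intro: order_embeddingI)
  qed (rule R_refl)
qed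

lemma psi_embedding_iff:
  "order_embedding (amalgam G) (amalgam G') \<psi> \<longleftrightarrow> polarity_embedding G G' hX hP hY"
proof
  show "polarity_embedding G G' hX hP hY" if "order_embedding (amalgam G) (amalgam G') \<psi>"
    using that unfolding psi_embedding_iff_reflects by (intro polarity_embedding_if_reflects) blast
  show "order_embedding (amalgam G) (amalgam G') \<psi>" if "polarity_embedding G G' hX hP hY"
    unfolding psi_embedding_iff_reflects
    by (intro ballI impI reflects_if_polarity_embedding[OF that])
qed

text \<open>On representatives, \<psi> acts as \<open>h\<close>, whose image is the union of the
  images of \<open>hX\<close> and \<open>hY\<close>; every class of \<open>G'\<close> has a
  representative in that union.\<close>

lemma psi_surjective:
  assumes "hX ` dom.X = cod.X" "hY ` dom.Y = cod.Y"
  shows "\<psi> ` carrier (amalgam G) = carrier (amalgam G')"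
proof -
  have "\<psi> ` carrier (amalgam G) = iota G' ` h ` (dom.X \<union> dom.Y)"
    unfolding dom.carrier_amalgam image_image by (rule image_cong) (simp_all add: psi_iota)
  also have "h ` (dom.X \<union> dom.Y) = hX ` dom.X \<union> hY ` dom.Y"
    by (simp add: image_Un h_X h_Y cong: image_cong)
  finally show ?thesis by (simp add: assms cod.carrier_amalgam)
qed

end

theorem theorem7p13:
  fixes G :: "('p, 'a) polarity" and G' :: "('q, 'b) polarity"
    and hX :: "'a \<Rightarrow> 'b" and hP :: "'p \<Rightarrow> 'q" and hY :: "'a \<Rightarrow> 'b"
  assumes "galois_polarity G" and "galois_polarity G'"
    and "polarity_morphism G G' hX hP hY"
  shows
    "((\<forall>c\<in>carrier (amalgam G). \<exists>!d. (c, d) \<in> psi_graph G G' hX hY) \<and>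
      psi G G' hX hY \<in> carrier (amalgam G) \<rightarrow>\<^sub>E carrier (amalgam G') \<and>
      commutes_with G G' hX hP hY (psi G G' hX hY) \<and>
      (\<forall>\<psi> \<in> carrier (amalgam G) \<rightarrow>\<^sub>E carrier (amalgam G').
        commutes_with G G' hX hP hY \<psi> \<longrightarrow> \<psi> = psi G G' hX hY)) \<and>
     galois_stable G G' (psi G G' hX hY) \<and>
     (order_embedding (amalgam G) (amalgam G') (psi G G' hX hY) \<longleftrightarrow>
       polarity_embedding G G' hX hP hY) \<and>
     (hX ` carrier (polX G) = carrier (polX G') \<and> hY ` carrier (polY G) = carrier (polY G') \<longrightarrow>
       psi G G' hX hY ` carrier (amalgam G) = carrier (amalgam G'))"
proof -
  interpret galois_polarity_morphism G G' hX hP hY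
    using assms by (simp add: galois_polarity_morphism_def galois_polarity_morphism_axioms_def)
  show ?thesis
    by (intro conjI ballI impI psi_graph_functional psi_closed psi_commutes psi_galois_stable
        psi_embedding_iff psi_unique psi_surjective) auto
qed

end
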